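(* Let $(G,\circ)$ be a group, let $N_l, N_{l+1}, d^l, d^{l+1}\ge 1$ be integers, let $F^l=(f_0^l,\dots,f_{N_l-1}^l)$ be a tuple of functions $f_i^l:G\to\mathbb{R}^{d^l}$, and, for $0\le j\le N_{l+1}-1$, let $\Psi_j^{l+1}=(\Psi_j^{l+1,p})_{0\le p\le d^{l+1}-1}$ be a family of filters $\Psi_j^{l+1,p}:G\to\mathbb{R}^{d^l}$. Let $F^l\otimes\Psi_j^{l+1}:G\to\mathbb{R}^{d^{l+1}}$ denote the output, for capsule-type $j$, of the degree-centrality based routing layer (defined in the context), assumed to be well-defined. Then for every $g\in G$ and every $0\le j\le N_{l+1}-1$, $$[L_gF^l]\otimes\Psi_j^{l+1}=L_g\big[F^l\otimes\Psi_j^{l+1}\big],$$ where $[L_gf](x)=f(g^{-1}\circ x)$ for a function $f$ on $G$, and $L_gF^l=(L_gf_0^l,\dots,L_gf_{N_l-1}^l)$.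
   Context: Degree-centrality based routing layer. Let $(G,\circ)$ be a group. The input is a tuple $F^l=(f_0^l,\dots,f_{N_l-1}^l)$ of functions $f_i^l:G\to\mathbb{R}^{d^l}$, with components $f_{ik}^l$, $0\le k\le d^l-1$. For each $j\in\{0,\dots,N_{l+1}-1\}$ there are $d^{l+1}$ filters $\Psi_j^{l+1,p}:G\to\mathbb{R}^{d^l}$, $0\le p\le d^{l+1}-1$, with components $\Psi_{j,k}^{l+1,p}$, $0\le k\le d^l-1$. The layer output $F^l\otimes\Psi_j^{l+1}:=f_j^{l+1}:G\to\mathbb{R}^{d^{l+1}}$ is computed as follows, for all $g\in G$. 1. Predictions (group correlation $\star$): for $0\le i\le N_l-1$, $S_{ij}^{l+1}(g)\in\mathbb{R}^{d^{l+1}}$ has $p$-th component $$S_{ijp}^{l+1}(g)=(f_i^l\star\Psi_j^{l+1,p})(g)=\sum_{h\in G}\sum_{k=0}^{d^l-1}f_{ik}^l(h)\,\Psi_{j,k}^{l+1,p}(g^{-1}\circ h).$$ 2. Degree scores: for $0\le i,k\le N_l-1$, $$A_{ik}^j(g)=\frac{S_{ij}^{l+1}(g)\cdot S_{kj}^{l+1}(g)}{\|S_{ij}^{l+1}(g)\|\,\|S_{kj}^{l+1}(g)\|},\qquad \mathrm{Degree}_i^j(g)=\sum_{k=0}^{N_l-1}A_{ik}^j(g),\qquad c_{ij}^{l+1}(g)=\frac{\exp(\mathrm{Degree}_i^j(g))}{\sum_{k=0}^{N_l-1}\exp(\mathrm{Degree}_k^j(g))},$$ where $\cdot$ is the Euclidean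 dot product and $\|\cdot\|$ the Euclidean norm. 3. Aggregation: $s_j(g)=\sum_{i=0}^{N_l-1}c_{ij}^{l+1}(g)\,S_{ij}^{l+1}(g)$. 4. Squash: $f_j^{l+1}(g)=\dfrac{\|s_j(g)\|}{1+\|s_j(g)\|^2}\,s_j(g)$. The layer is well-defined on $F^l$ when all the sums over $h\in G$ in step 1 converge absolutely (automatic if $G$ is finite or the filters have finite support) and all the predictions $S_{ij}^{l+1}(g)$ are non-zero, so that the quotients in step 2 make sense. *)

theory Defs
  imports "HOL-Analysis.Analysis" "HOL-Algebra.Group"
begin

text \<open>
  Functions on the group are HOL functions of which only the values on \<open>carrier G\<close> matter.
  The dimensions of the input and output vectors are \<open>CARD('d)\<close> and \<open>CARD('e)\<close>; the tuple of
  input functions is \<open>F 0, \<dots>, F (N - 1)\<close>. In all definitions up to \<open>routing_layer\<close>, \<open>\<Psi>\<close> stands for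
  the filter family of one fixed output capsule type.
\<close>

definition left_translate :: "('g, 'm) monoid_scheme \<Rightarrow> 'g \<Rightarrow> ('g \<Rightarrow> 'b) \<Rightarrow> 'g \<Rightarrow> 'b"
  where "left_translate G g f = (\<lambda>x. f (inv\<^bsub>G\<^esub> g \<otimes>\<^bsub>G\<^esub> x))"

definition correlation_term ::
    "('g, 'm) monoid_scheme \<Rightarrow> ('g \<Rightarrow> real ^ 'd) \<Rightarrow> ('g \<Rightarrow> real ^ 'd) \<Rightarrow> 'g \<Rightarrow> 'g \<Rightarrow> real"
  where "correlation_term G f \<psi> g h = (\<Sum>k\<in>UNIV. f h $ k * \<psi> (inv\<^bsub>G\<^esub> g \<otimes>\<^bsub>G\<^esub> h) $ k)"

definition group_correlation ::
    "('g, 'm) monoid_scheme \<Rightarrow> ('g \<Rightarrow> real ^ 'd) \<Rightarrow> ('g \<Rightarrow> real ^ 'd) \<Rightarrow> 'g \<Rightarrow> real"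
  where "group_correlation G f \<psi> g = (\<Sum>\<^sub>\<infinity>h\<in>carrier G. correlation_term G f \<psi> g h)"

definition prediction ::
    "('g, 'm) monoid_scheme \<Rightarrow> ('g \<Rightarrow> real ^ 'd) \<Rightarrow> ('e::finite \<Rightarrow> 'g \<Rightarrow> real ^ 'd) \<Rightarrow> 'g \<Rightarrow> real ^ 'e"
  where "prediction G f \<Psi> g = (\<chi> p. group_correlation G f (\<Psi> p) g)"

definition similarity ::
    "('g, 'm) monoid_scheme \<Rightarrow> (nat \<Rightarrow> 'g \<Rightarrow> real ^ 'd) \<Rightarrow> ('e::finite \<Rightarrow> 'g \<Rightarrow> real ^ 'd) \<Rightarrow>
      nat \<Rightarrow> nat \<Rightarrow> 'g \<Rightarrow> real"
  where "similarity G F \<Psi> i k g =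
    (prediction G (F i) \<Psi> g \<bullet> prediction G (F k) \<Psi> g) /
    (norm (prediction G (F i) \<Psi> g) * norm (prediction G (F k) \<Psi> g))"

definition degree_score ::
    "('g, 'm) monoid_scheme \<Rightarrow> nat \<Rightarrow> (nat \<Rightarrow> 'g \<Rightarrow> real ^ 'd) \<Rightarrow>
      ('e::finite \<Rightarrow> 'g \<Rightarrow> real ^ 'd) \<Rightarrow> nat \<Rightarrow> 'g \<Rightarrow> real"
  where "degree_score G N F \<Psi> i g = (\<Sum>k<N. similarity G F \<Psi> i k g)"

definition routing_weight ::
    "('g, 'm) monoid_scheme \<Rightarrow> nat \<Rightarrow> (nat \<Rightarrow> 'g \<Rightarrow> real ^ 'd) \<Rightarrow>
      ('e::finite \<Rightarrow> 'g \<Rightarrow> real ^ 'd) \<Rightarrow> nat \<Rightarrow> 'g \<Rightarrow> real"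
  where "routing_weight G N F \<Psi> i g =
    exp (degree_score G N F \<Psi> i g) / (\<Sum>k<N. exp (degree_score G N F \<Psi> k g))"

definition aggregation ::
    "('g, 'm) monoid_scheme \<Rightarrow> nat \<Rightarrow> (nat \<Rightarrow> 'g \<Rightarrow> real ^ 'd) \<Rightarrow>
      ('e::finite \<Rightarrow> 'g \<Rightarrow> real ^ 'd) \<Rightarrow> 'g \<Rightarrow> real ^ 'e"
  where "aggregation G N F \<Psi> g =
    (\<Sum>i<N. routing_weight G N F \<Psi> i g *\<^sub>R prediction G (F i) \<Psi> g)"

definition squash :: "real ^ 'e \<Rightarrow> real ^ 'e"
  where "squash s = (norm s / (1 + (norm s)\<^sup>2)) *\<^sub>R s"

definition routing_layer ::
    "('g, 'm) monoid_scheme \<Rightarrow> nat \<Rightarrow> (nat \<Rightarrow> 'g \<Rightarrow> real ^ 'd) \<Rightarrow>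
      ('e::finite \<Rightarrow> 'g \<Rightarrow> real ^ 'd) \<Rightarrow> 'g \<Rightarrow> real ^ 'e"
  where "routing_layer G N F \<Psi> g = squash (aggregation G N F \<Psi> g)"

text \<open>
  The conditions under which the totalised operations above have their intended meaning: otherwise
  the infinite sum may take the default value 0, and the quotient in \<open>similarity\<close> is a division by 0.
\<close>

definition routing_well_defined ::
    "('g, 'm) monoid_scheme \<Rightarrow> nat \<Rightarrow> (nat \<Rightarrow> 'g \<Rightarrow> real ^ 'd) \<Rightarrow>
      ('e::finite \<Rightarrow> 'g \<Rightarrow> real ^ 'd) \<Rightarrow> bool"
  where "routing_well_defined G N F \<Psi> \<longleftrightarrow>
    (\<forall>i<N. \<forall>g\<in>carrier G.
      (\<forall>p. (\<lambda>h. \<bar>correlation_term G (F i) (\<Psi> p) g h\<bar>) summable_on carrier G) \<and>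
      prediction G (F i) \<Psi> g \<noteq> 0)"

end

theory Submission
  imports Defs
begin

text \<open>
  Substituting \<open>h = g \<circ> h'\<close> in the correlation sum of \<open>L\<^sub>g f\<close> at \<open>x\<close> turns it into the sum for \<open>f\<close> at
  \<open>g\<inverse> \<circ> x\<close>, so the predictions are equivariant. All later steps act on the predictions pointwise
  in the group element and hence inherit the equivariance.
\<close>

lemma (in group) bij_betw_left_mult:
  assumes "g \<in> carrier G"
  shows "bij_betw (\<lambda>h. g \<otimes> h) (carrier G) (carrier G)"
  using assms by (simp add: bij_betw_def inj_on_cmult surj_const_mult)

text \<open>Since \<open>inv (inv g \<otimes> x) \<otimes> (inv g \<otimes> h) = inv x \<otimes>
  h\<close>, the filter is evaluated at the same point on both sides.\<close>

lemma (in group) correlation_term_left_translate: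
  assumes "g \<in> carrier G" "x \<in> carrier G" "h \<in> carrier G"
  shows "correlation_term G (left_translate G g f) \<psi> x h =
    correlation_term G f \<psi> (inv g \<otimes> x) (inv g \<otimes> h)"
proof -
  have "inv (inv g \<otimes> x) \<otimes> (inv g \<otimes> h) = inv x \<otimes> (g \<otimes> (inv g \<otimes> h))"
    using assms by (simp add: inv_mult_group m_assoc)
  also have "\<dots> = inv x \<otimes> h"
    \<comment> \<open>The flipped associativity brings \<open>g\<close> next to
      \<open>inv g\<close>, and the two cancel.\<close>
    using assms by (simp flip: m_assoc add: m_assoc[of "inv x"])
  finally show ?thesis
    by (simp add: correlation_term_def left_translate_def)
qed

text \<open>Left multiplication by \<open>inv g\<close> permutes the carrier. This transfers the
  convergence half of \<open>routing_well_defined\<close>.\<close>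

lemma (in group) correlation_summable_left_translate_iff:
  assumes "g \<in> carrier G" "x \<in> carrier G"
  shows "(\<lambda>h. \<bar>correlation_term G (left_translate G g f) \<psi> x h\<bar>) summable_on carrier G \<longleftrightarrow>
    (\<lambda>h. \<bar>correlation_term G f \<psi> (inv g \<otimes> x) h\<bar>) summable_on carrier G"
proof -
  have "(\<lambda>h. \<bar>correlation_term G (left_translate G g f) \<psi> x h\<bar>) summable_on carrier G \<longleftrightarrow>
      (\<lambda>h. \<bar>correlation_term G f \<psi> (inv g \<otimes> x) (inv g \<otimes> h)\<bar>) summable_on carrier G"
    using assms by (intro summable_on_cong) (simp add: correlation_term_left_translate)
  also have "\<dots> \<longleftrightarrow> (\<lambda>h. \<bar>correlation_term G f \<psi> (inv g \<otimes> x) h\<bar>) summable_on carrier G"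
    using assms by (intro summable_on_reindex_bij_betw bij_betw_left_mult inv_closed)
  finally show ?thesis .
qed

lemma (in group) group_correlation_left_translate:
  assumes "g \<in> carrier G" "x \<in> carrier G"
  shows "group_correlation G (left_translate G g f) \<psi> x = group_correlation G f \<psi> (inv g \<otimes> x)"
proof -
  have "group_correlation G (left_translate G g f) \<psi> x =
      (\<Sum>\<^sub>\<infinity>h\<in>carrier G. correlation_term G f \<psi> (inv g \<otimes> x) (inv g \<otimes> h))"
    unfolding group_correlation_def
    using assms by (intro infsum_cong) (simp add: correlation_term_left_translate)
  also have "\<dots> = group_correlation G f \<psi> (inv g \<otimes> x)"
    unfolding group_correlation_def
    \<comment> \<open>A bijection preserves summability too, so both sums take the default value 0
      together.\<close>
    using assms by (intro infsum_reindex_bij_betw bij_betw_left_mult inv_closed)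
  finally show ?thesis .
qed

lemma (in group) prediction_left_translate:
  assumes "g \<in> carrier G" "x \<in> carrier G"
  shows "prediction G (left_translate G g f) \<Psi> x = prediction G f \<Psi> (inv g \<otimes> x)"
  using assms by (simp add: prediction_def group_correlation_left_translate)

lemma (in group) routing_layer_left_translate:
  assumes "g \<in> carrier G" "x \<in> carrier G"
  shows "routing_layer G N (\<lambda>i. left_translate G g (F i)) \<Psi> x =
    left_translate G g (routing_layer G N F \<Psi>) x"
  using assms
  \<comment> \<open>Only the outer translation is unfolded; the translated inputs must stay folded
    for \<open>prediction_left_translate\<close> to match.\<close>
  by (simp add: left_translate_def[of G g "routing_layer G N F \<Psi>"] routing_layer_def
      aggregation_def routing_weight_def degree_score_def similarity_def prediction_left_translate)

text \<open>The conditions for the translate at \<open>x\<close> are those for \<open>F\<close> at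
  \<open>inv g \<otimes> x\<close>, which is again in the carrier.\<close>

lemma (in group) routing_well_defined_left_translate:
  assumes "routing_well_defined G N F \<Psi>" "g \<in> carrier G"
  shows "routing_well_defined G N (\<lambda>i. left_translate G g (F i)) \<Psi>"
  using assms
  by (simp add: routing_well_defined_def prediction_left_translate
      correlation_summable_left_translate_iff)

text \<open>Well-definedness on the translated input is part of the conclusion, so that the left
  side of the equation also has its intended meaning.\<close>

theorem theorem2p1:
  fixes G :: "('g, 'm) monoid_scheme"
    and N N' :: nat
    and F :: "nat \<Rightarrow> 'g \<Rightarrow> real ^ 'd"
    and \<Psi> :: "nat \<Rightarrow> 'e::finite \<Rightarrow> 'g \<Rightarrow> real ^ 'd"
  assumes "group G"
    and "N \<ge> 1" and "N' \<ge> 1"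
    and "\<And>j. j < N' \<Longrightarrow> routing_well_defined G N F (\<Psi> j)"
  shows "\<forall>g\<in>carrier G. \<forall>j<N'.
    routing_well_defined G N (\<lambda>i. left_translate G g (F i)) (\<Psi> j) \<and>
    (\<forall>x\<in>carrier G.
      routing_layer G N (\<lambda>i. left_translate G g (F i)) (\<Psi> j) x =
      left_translate G g (routing_layer G N F (\<Psi> j)) x)"
  using assms
  by (blast intro: group.routing_layer_left_translate group.routing_well_defined_left_translate)

end
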